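(* For $i=1,2$ let $(p_{n_i})_{n_i\ge 1}$ and $(q_{n_i})_{n_i\ge 1}$ be real sequences with $0<q_{n_i}<p_{n_i}\le 1$ and $p_{n_i}\to 1$, $q_{n_i}\to 1$ as $n_i\to\infty$. Let $\omega$ be a function of modulus-of-continuity type, and let $L_{n_1,n_2}=L_{n_1,n_2}^{(p_{n_1},p_{n_2}),(q_{n_1},q_{n_2})}:H_\omega(\mathbb{R}_+^2)\to C_B(\mathbb{R}_+^2)$ be the $(p,q)$-bivariate Bleimann-Butzer-Hahn operators, satisfying $$\lim_{n_1,n_2\to\infty}\|L_{n_1,n_2}(e_{ij})-e_{ij}\|_{C_B(\mathbb{R}_+^2)}=0\quad\text{for }(i,j)\in\{(0,0),(1,0),(0,1),(2,0),(0,2)\}.$$ Then for every $f\in H_\omega(\mathbb{R}_+^2)$, $L_{n_1,n_2}(f)$ converges uniformly to $f$, that is, $$\lim_{n_1,n_2\to\infty}\|L_{n_1,n_2}(f;x,y)-f(x,y)\|_{C_B(\mathbb{R}_+^2)}=0.$$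
   Context: $\mathbb{R}_+=[0,\infty)$, $\mathbb{R}_+^2=[0,\infty)\times[0,\infty)$. $C_B(\mathbb{R}_+^2)$ is the space of bounded continuous real functions on $\mathbb{R}_+^2$ with norm $\|f\|_{C_B(\mathbb{R}_+^2)}=\sup_{x,y\ge 0}|f(x,y)|$. A function of modulus-of-continuity type is a function $\omega$ such that: (a) $\omega$ is a non-negative increasing function on $\mathbb{R}_+$; (b) $\omega(\delta_1+\delta_2)\le\omega(\delta_1)+\omega(\delta_2)$; (c) $\lim_{\delta\to 0}\omega(\delta)=0$. $H_\omega(\mathbb{R}_+^2)$ is the set of real-valued functions $f$ on $\mathbb{R}_+^2$ such that for all $(u,v),(x,y)\in\mathbb{R}_+^2$ $$|f(u,v)-f(x,y)|\le\omega\left(\left|\left(\tfrac{u}{1+u},\tfrac{v}{1+v}\right)-\left(\tfrac{x}{1+x},\tfrac{y}{1+y}\right)\right|\right),$$ with the Euclidean norm on $\mathbb{R}^2$ on the right. Test functions: $e_{ij}(u,v)=\left(\frac{u}{1+u}\right)^i\left(\frac{v}{1+v}\right)^j$. $(p,q)$-calculus: for $0<q<p\le1$, $[n]_{p,q}=\frac{p^n-q^n}{p-q}$ for $n=0,1,2,\dots$; $[n]_{p,q}!=[1]_{p,q}[2]_{p,q}\cdots[n]_{p,q}$, $[0]_{p,q}!=1$; $\begin{bmatrix}n\\k\end{bmatrix}_{p,q}=\frac{[n]_{p,q}!}{[k]_{p,q}!\,[n-k]_{p,q}!}$. For $n\ge1$ and $x\ge 0$ put $\ell_n^{(p,q)}(x)=\prod_{s=0}^{n-1}(p^s+q^sx)$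 and, for $0\le k\le n$, $$w_{n,k}^{(p,q)}(x)=\frac{1}{\ell_n^{(p,q)}(x)}\,p^{\frac{(n-k)(n-k-1)}{2}}q^{\frac{k(k-1)}{2}}\begin{bmatrix}n\\k\end{bmatrix}_{p,q}x^k,\qquad \xi_{n,k}^{(p,q)}=\frac{p^{n-k+1}[k]_{p,q}}{[n-k+1]_{p,q}\,q^k}.$$ The $(p,q)$-bivariate Bleimann-Butzer-Hahn operator is, for $f:\mathbb{R}_+^2\to\mathbb{R}$ and $x,y\ge0$, $$L_{n_1,n_2}^{(p_{n_1},p_{n_2}),(q_{n_1},q_{n_2})}(f;x,y)=\sum_{k_1=0}^{n_1}\sum_{k_2=0}^{n_2}f\left(\xi_{n_1,k_1}^{(p_{n_1},q_{n_1})},\xi_{n_2,k_2}^{(p_{n_2},q_{n_2})}\right)w_{n_1,k_1}^{(p_{n_1},q_{n_1})}(x)\,w_{n_2,k_2}^{(p_{n_2},q_{n_2})}(y).$$ The limit $n_1,n_2\to\infty$ is the joint limit in which both indices tend to infinity. *)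

theory Defs
  imports "HOL-Analysis.Analysis"
begin

section \<open>Function spaces on the closed quadrant\<close>

text \<open>Functions on the quadrant are total functions on \<^typ>\<open>real \<times> real\<close> whose values
  outside the quadrant are never used.\<close>

definition quadrant :: "(real \<times> real) set" where
  "quadrant = {0..} \<times> {0..}"

definition CB :: "(real \<times> real \<Rightarrow> real) set" where
  "CB = {f. continuous_on quadrant f \<and> bounded (f ` quadrant)}"

text \<open>The supremum is taken in the conditionally complete lattice of the reals, so it is the
  supremum norm only for functions that are bounded on the quadrant, in particular on \<open>CB\<close>.\<close>

definition CB_norm :: "(real \<times> real \<Rightarrow> real) \<Rightarrow> real" where
  "CB_norm f = (SUP z\<in>quadrant. \<bar>f z\<bar>)"

definition modulus_type :: "(real \<Rightarrow> real) \<Rightarrow> bool" where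
  "modulus_type \<omega> \<longleftrightarrow>
     (\<forall>\<delta>\<ge>0. 0 \<le> \<omega> \<delta>) \<and>
     mono_on {0..} \<omega> \<and>
     (\<forall>\<delta>\<^sub>1\<ge>0. \<forall>\<delta>\<^sub>2\<ge>0. \<omega> (\<delta>\<^sub>1 + \<delta>\<^sub>2) \<le> \<omega> \<delta>\<^sub>1 + \<omega> \<delta>\<^sub>2) \<and>
     (\<omega> \<longlongrightarrow> 0) (at 0 within {0..})"

text \<open>The norm on \<^typ>\<open>real \<times> real\<close> is the Euclidean one.\<close>

definition H_omega :: "(real \<Rightarrow> real) \<Rightarrow> (real \<times> real \<Rightarrow> real) set" where
  "H_omega \<omega> = {f. \<forall>u\<ge>0. \<forall>v\<ge>0. \<forall>x\<ge>0. \<forall>y\<ge>0.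
     \<bar>f (u, v) - f (x, y)\<bar> \<le> \<omega> (norm ((u / (1 + u), v / (1 + v)) - (x / (1 + x), y / (1 + y))))}"

definition test_fun :: "nat \<Rightarrow> nat \<Rightarrow> real \<times> real \<Rightarrow> real" where
  "test_fun i j = (\<lambda>(u, v). (u / (1 + u)) ^ i * (v / (1 + v)) ^ j)"


section \<open>The bivariate \<open>(p,q)\<close>-Bleimann-Butzer-Hahn operators\<close>

definition pq_int :: "real \<Rightarrow> real \<Rightarrow> nat \<Rightarrow> real" where
  "pq_int p q n = (p ^ n - q ^ n) / (p - q)"

definition pq_fact :: "real \<Rightarrow> real \<Rightarrow> nat \<Rightarrow> real" where
  "pq_fact p q n = (\<Prod>i=1..n. pq_int p q i)"

definition pq_binom :: "real \<Rightarrow> real \<Rightarrow> nat \<Rightarrow> nat \<Rightarrow> real" where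
  "pq_binom p q n k = pq_fact p q n / (pq_fact p q k * pq_fact p q (n - k))"

definition BBH_ell :: "real \<Rightarrow> real \<Rightarrow> nat \<Rightarrow> real \<Rightarrow> real" where
  "BBH_ell p q n x = (\<Prod>s=0..<n. p ^ s + q ^ s * x)"

definition BBH_weight :: "real \<Rightarrow> real \<Rightarrow> nat \<Rightarrow> nat \<Rightarrow> real \<Rightarrow> real" where
  "BBH_weight p q n k x = 1 / BBH_ell p q n x *
     p ^ ((n - k) * (n - k - 1) div 2) * q ^ (k * (k - 1) div 2) * pq_binom p q n k * x ^ k"

definition BBH_node :: "real \<Rightarrow> real \<Rightarrow> nat \<Rightarrow> nat \<Rightarrow> real" where
  "BBH_node p q n k = p ^ (n - k + 1) * pq_int p q k / (pq_int p q (n - k + 1) * q ^ k)"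

definition BBH ::
  "real \<Rightarrow> real \<Rightarrow> real \<Rightarrow> real \<Rightarrow> nat \<Rightarrow> nat \<Rightarrow> (real \<times> real \<Rightarrow> real) \<Rightarrow> real \<times> real \<Rightarrow> real" where
  "BBH p1 p2 q1 q2 n1 n2 f = (\<lambda>(x, y).
     \<Sum>k1=0..n1. \<Sum>k2=0..n2. f (BBH_node p1 q1 n1 k1, BBH_node p2 q2 n2 k2) *
       BBH_weight p1 q1 n1 k1 x * BBH_weight p2 q2 n2 k2 y)"


section \<open>Membership in the space of bounded continuous functions\<close>

text \<open>All functions whose norm \<open>CB_norm\<close> is considered belong to \<open>CB\<close>, so the supremum is a
  genuine one.\<close>

lemma CB_diff: "f \<in> CB \<Longrightarrow> g \<in> CB \<Longrightarrow> (\<lambda>z. f z - g z) \<in> CB"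
  unfolding CB_def by (auto intro: continuous_on_diff bounded_minus_comp)

lemma test_fun_in_CB: "test_fun i j \<in> CB"
proof -
  have "continuous_on quadrant (test_fun i j)"
    unfolding test_fun_def quadrant_def case_prod_unfold
    by (intro continuous_intros) auto
  moreover have "\<bar>test_fun i j z\<bar> \<le> 1" if "z \<in> quadrant" for z
  proof -
    have *: "0 \<le> t / (1 + t)" "t / (1 + t) \<le> 1" if "t \<ge> 0" for t :: real
      using that by (auto simp: field_simps)
    show ?thesis
      using that *[of "fst z"] *[of "snd z"]
      by (auto simp: test_fun_def quadrant_def abs_mult power_le_one intro!: mult_le_one)
  qed
  ultimately show ?thesis
    unfolding CB_def bounded_iff by (auto intro!: exI[of _ 1])
qed

lemma H_omega_subset_CB:
  assumes "modulus_type \<omega>"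
  shows "H_omega \<omega> \<subseteq> CB"
proof
  fix f assume f: "f \<in> H_omega \<omega>"
  define \<phi> :: "real \<times> real \<Rightarrow> real \<times> real" where
    "\<phi> = (\<lambda>z. (fst z / (1 + fst z), snd z / (1 + snd z)))"
  have H: "\<bar>f z - f w\<bar> \<le> \<omega> (norm (\<phi> z - \<phi> w))" if "z \<in> quadrant" "w \<in> quadrant" for z w
    using f that unfolding H_omega_def quadrant_def \<phi>_def by auto
  have cont: "continuous_on quadrant \<phi>"
    unfolding \<phi>_def quadrant_def by (intro continuous_intros) auto
  have lim: "(\<omega> \<longlongrightarrow> 0) (at 0 within {0..})" and mono: "mono_on {0..} \<omega>"
    and nn: "\<And>d. d \<ge> 0 \<Longrightarrow> 0 \<le> \<omega> d"
    using assms unfolding modulus_type_def by auto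
  have "continuous_on quadrant f"
    unfolding continuous_on_iff
  proof (intro ballI allI impI)
    fix w and e :: real assume w: "w \<in> quadrant" and e: "e > 0"
    obtain d where d: "d > 0" "\<And>t. t \<in> {0..} \<Longrightarrow> t \<noteq> 0 \<Longrightarrow> dist t 0 < d \<Longrightarrow> dist (\<omega> t) 0 < e"
      using lim e unfolding Lim_within by (metis zero_less_dist_iff)
    obtain d' where d': "d' > 0" "\<And>z. z \<in> quadrant \<Longrightarrow> dist z w < d' \<Longrightarrow> dist (\<phi> z) (\<phi> w) < d / 2"
      using cont w d(1) unfolding continuous_on_iff by (metis half_gt_zero)
    have "dist (f z) (f w) < e" if z: "z \<in> quadrant" "dist z w < d'" for z
    proof -
      have "\<bar>f z - f w\<bar> \<le> \<omega> (norm (\<phi> z - \<phi> w))" using H z w by blast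
      also have "\<dots> \<le> \<omega> (d / 2)"
        using d'(2)[OF z] d(1) by (intro mono_onD[OF mono]) (auto simp: dist_norm)
      also have "\<dots> < e" using d(2)[of "d / 2"] d(1) by auto
      finally show ?thesis by (simp add: dist_real_def)
    qed
    then show "\<exists>d>0. \<forall>z\<in>quadrant. dist z w < d \<longrightarrow> dist (f z) (f w) < e"
      using d'(1) by blast
  qed
  moreover have "\<bar>f z\<bar> \<le> \<bar>f (0, 0)\<bar> + \<omega> 2" if z: "z \<in> quadrant" for z
  proof -
    have *: "\<bar>t / (1 + t)\<bar> \<le> 1" if "t \<ge> 0" for t :: real
      using that by (auto simp: field_simps)
    have "norm (\<phi> z - \<phi> (0, 0)) \<le> \<bar>fst z / (1 + fst z)\<bar> + \<bar>snd z / (1 + snd z)\<bar>"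
      unfolding \<phi>_def using norm_Pair_le[of "fst z / (1 + fst z)" "snd z / (1 + snd z)"] by simp
    also have "\<dots> \<le> 2"
      proof -
      have "fst z \<ge> 0" "snd z \<ge> 0" using z by (auto simp: quadrant_def)
      from *[OF this(1)] *[OF this(2)] show ?thesis by linarith
    qed
    finally have "\<omega> (norm (\<phi> z - \<phi> (0, 0))) \<le> \<omega> 2"
      by (intro mono_onD[OF mono]) auto
    moreover have "(0, 0) \<in> quadrant" by (simp add: quadrant_def)
    ultimately show ?thesis using H[OF z, of "(0, 0)"] by linarith
  qed
  ultimately show "f \<in> CB"
    unfolding CB_def bounded_iff by (auto intro!: exI[of _ "\<bar>f (0, 0)\<bar> + \<omega> 2"])
qed

lemma BBH_ell_pos:
  assumes "0 < q" "0 < p" "x \<ge> 0"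
  shows "BBH_ell p q n x > 0"
  unfolding BBH_ell_def using assms by (intro prod_pos) (auto intro!: add_pos_nonneg)

lemma BBH_weight_continuous:
  assumes "0 < q" "0 < p"
  shows "continuous_on {0..} (BBH_weight p q n k)"
proof -
  have "continuous_on {0..} (BBH_ell p q n)"
    unfolding BBH_ell_def by (intro continuous_intros)
  then show ?thesis
    unfolding BBH_weight_def using BBH_ell_pos[OF assms]
    by (intro continuous_intros) (auto simp: less_imp_neq[THEN not_sym])
qed

lemma BBH_weight_bounded:
  assumes "0 < q" "0 < p" "k \<le> n"
  shows "\<exists>C. \<forall>x\<ge>0. \<bar>BBH_weight p q n k x\<bar> \<le> C"
proof -
  define c where "c = (\<Prod>s=0..<k. q ^ s) * (\<Prod>s=k..<n. p ^ s)"
  define A where "A = p ^ ((n - k) * (n - k - 1) div 2) * q ^ (k * (k - 1) div 2) * pq_binom p q n k"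
  have c: "c > 0" unfolding c_def using assms by (auto intro!: mult_pos_pos prod_pos)
  have "\<bar>BBH_weight p q n k x\<bar> \<le> \<bar>A\<bar> / c" if x: "x \<ge> 0" for x
  proof -
    have "c * x ^ k = (\<Prod>s=0..<k. q ^ s * x) * (\<Prod>s=k..<n. p ^ s)"
      by (simp add: c_def prod.distrib)
    also have "\<dots> \<le> (\<Prod>s=0..<k. p ^ s + q ^ s * x) * (\<Prod>s=k..<n. p ^ s + q ^ s * x)"
      using assms x by (intro mult_mono prod_mono prod_nonneg) auto
    also have "\<dots> = BBH_ell p q n x"
      unfolding BBH_ell_def using assms(3) by (simp add: prod.atLeastLessThan_concat)
    finally have le: "c * x ^ k \<le> BBH_ell p q n x" .
    have pos: "BBH_ell p q n x > 0" using BBH_ell_pos assms x by blast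
    have "x ^ k / BBH_ell p q n x \<le> 1 / c"
      using le pos c by (simp add: field_simps)
    then have "\<bar>A\<bar> * (x ^ k / BBH_ell p q n x) \<le> \<bar>A\<bar> * (1 / c)"
      by (intro mult_left_mono) auto
    moreover have "\<bar>BBH_weight p q n k x\<bar> = \<bar>A\<bar> * (x ^ k / BBH_ell p q n x)"
      using pos x by (simp add: BBH_weight_def A_def abs_mult)
    ultimately show ?thesis by simp
  qed
  then show ?thesis by blast
qed

lemma BBH_in_CB:
  assumes "0 < q1" "0 < p1" "0 < q2" "0 < p2"
  shows "BBH p1 p2 q1 q2 n1 n2 f \<in> CB"
proof -
  have c1: "continuous_on quadrant (\<lambda>z. BBH_weight p1 q1 n1 k (fst z))" for k
    using BBH_weight_continuous[OF assms(1,2)]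
    by (rule continuous_on_compose2) (auto simp: quadrant_def intro!: continuous_intros)
  have c2: "continuous_on quadrant (\<lambda>z. BBH_weight p2 q2 n2 k (snd z))" for k
    using BBH_weight_continuous[OF assms(3,4)]
    by (rule continuous_on_compose2) (auto simp: quadrant_def intro!: continuous_intros)
  have "continuous_on quadrant (BBH p1 p2 q1 q2 n1 n2 f)"
    unfolding BBH_def case_prod_unfold by (intro continuous_intros c1 c2)
  moreover have "\<exists>C. \<forall>z\<in>quadrant. \<bar>BBH p1 p2 q1 q2 n1 n2 f z\<bar> \<le> C"
  proof -
    obtain C1 where C1: "\<And>k x. k \<le> n1 \<Longrightarrow> x \<ge> 0 \<Longrightarrow> \<bar>BBH_weight p1 q1 n1 k x\<bar> \<le> C1 k"
      using BBH_weight_bounded[OF assms(1,2), of _ n1] by (metis (no_types, lifting))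
    obtain C2 where C2: "\<And>k x. k \<le> n2 \<Longrightarrow> x \<ge> 0 \<Longrightarrow> \<bar>BBH_weight p2 q2 n2 k x\<bar> \<le> C2 k"
      using BBH_weight_bounded[OF assms(3,4), of _ n2] by (metis (no_types, lifting))
    let ?F = "\<lambda>k1 k2. f (BBH_node p1 q1 n1 k1, BBH_node p2 q2 n2 k2)"
    have "\<bar>BBH p1 p2 q1 q2 n1 n2 f (x, y)\<bar> \<le> (\<Sum>k1=0..n1. \<Sum>k2=0..n2. \<bar>?F k1 k2\<bar> * C1 k1 * C2 k2)"
      if xy: "x \<ge> 0" "y \<ge> 0" for x y
    proof -
      have bnd: "\<bar>?F k1 k2 * BBH_weight p1 q1 n1 k1 x * BBH_weight p2 q2 n2 k2 y\<bar>
          \<le> \<bar>?F k1 k2\<bar> * C1 k1 * C2 k2" if "k1 \<in> {0..n1}" "k2 \<in> {0..n2}" for k1 k2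
      proof -
        have 1: "\<bar>BBH_weight p1 q1 n1 k1 x\<bar> \<le> C1 k1" using C1 that xy by simp
        have 2: "\<bar>BBH_weight p2 q2 n2 k2 y\<bar> \<le> C2 k2" using C2 that xy by simp
        have "0 \<le> C1 k1" using 1 by linarith
        then show ?thesis
          unfolding abs_mult using 1 2 by (intro mult_mono mult_nonneg_nonneg) auto
      qed
      have "\<bar>\<Sum>k2=0..n2. ?F k1 k2 * BBH_weight p1 q1 n1 k1 x * BBH_weight p2 q2 n2 k2 y\<bar>
          \<le> (\<Sum>k2=0..n2. \<bar>?F k1 k2\<bar> * C1 k1 * C2 k2)" if "k1 \<in> {0..n1}" for k1
        by (rule order_trans[OF sum_abs sum_mono]) (rule bnd[OF that])
      then show ?thesis
        unfolding BBH_def case_prod_conv by (rule order_trans[OF sum_abs sum_mono])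
    qed
    then show ?thesis by (auto simp: quadrant_def)
  qed
  ultimately show ?thesis
    unfolding CB_def bounded_iff by auto
qed

end

theory Submission
  imports Defs
begin

text \<open>Korovkin's argument. In the coordinates \<open>(u / (1 + u), v / (1 + v))\<close> every \<open>f\<close> in the class
  satisfies \<open>\<bar>f t - f z\<bar> \<le> \<epsilon> + K d\<^sup>2\<close>, where \<open>d\<close> is the distance of \<open>t\<close> and \<open>z\<close> and \<open>K\<close> depends
  only on \<open>f\<close> and \<open>\<epsilon>\<close>. Positivity of the weights lets the operator act on this inequality, and its value
  on \<open>d\<^sup>2\<close>, expanded in the five test functions, tends to \<open>0\<close> uniformly in \<open>z\<close>.\<close>

text \<open>This map carries the quadrant into the unit square, turns the test functions into
  monomials, and supplies the distance in which \<open>H_omega\<close> measures oscillation.\<close>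

definition squash :: "real \<times> real \<Rightarrow> real \<times> real" where
  "squash z = (fst z / (1 + fst z), snd z / (1 + snd z))"

lemma test_fun_squash: "test_fun i j z = fst (squash z) ^ i * snd (squash z) ^ j"
  by (simp add: test_fun_def squash_def case_prod_unfold)

lemma squash_bounds:
  assumes "z \<in> quadrant"
  shows "0 \<le> fst (squash z)" "fst (squash z) \<le> 1" "0 \<le> snd (squash z)" "snd (squash z) \<le> 1"
  using assms by (auto simp: squash_def quadrant_def field_simps)

lemma H_omega_squash:
  assumes "f \<in> H_omega \<omega>" "u \<in> quadrant" "z \<in> quadrant"
  shows "\<bar>f u - f z\<bar> \<le> \<omega> (norm (squash u - squash z))"
  using assms by (auto simp: H_omega_def quadrant_def squash_def)

lemma abs_le_CB_norm:
  assumes "f \<in> CB" "z \<in> quadrant"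
  shows "\<bar>f z\<bar> \<le> CB_norm f"
proof -
  obtain B where "\<And>z. z \<in> quadrant \<Longrightarrow> \<bar>f z\<bar> \<le> B"
    using assms(1) by (auto simp: CB_def bounded_iff)
  then have "bdd_above ((\<lambda>z. \<bar>f z\<bar>) ` quadrant)"
    by (auto intro!: bdd_aboveI)
  then show ?thesis
    unfolding CB_norm_def using assms(2) by (rule cSUP_upper[rotated])
qed

lemma CB_norm_le:
  assumes "\<And>z. z \<in> quadrant \<Longrightarrow> \<bar>f z\<bar> \<le> B"
  shows "CB_norm f \<le> B"
  unfolding CB_norm_def using assms by (intro cSUP_least) (auto simp: quadrant_def)

lemma CB_norm_nonneg:
  assumes "f \<in> CB"
  shows "0 \<le> CB_norm f"
  using abs_le_CB_norm[OF assms, of "(0, 0)"] by (simp add: quadrant_def)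

text \<open>If the images under \<open>squash\<close> are close, the modulus alone gives \<epsilon>.
  If they are far apart, boundedness of \<open>f\<close> suffices, because the squared distance is
  then bounded below and a large \<open>K\<close> absorbs twice the norm of
  \<open>f\<close>.\<close>

lemma H_omega_quadratic_bound:
  assumes "modulus_type \<omega>" "f \<in> H_omega \<omega>" "\<epsilon> > 0"
  obtains K where "K \<ge> 0" "\<And>u z. u \<in> quadrant \<Longrightarrow> z \<in> quadrant \<Longrightarrow>
    \<bar>f u - f z\<bar> \<le> \<epsilon> + K * (norm (squash u - squash z))\<^sup>2"
proof -
  have lim: "(\<omega> \<longlongrightarrow> 0) (at 0 within {0..})" and mono: "mono_on {0..} \<omega>"
    using assms(1) by (auto simp: modulus_type_def)
  obtain d where d: "d > 0" "\<And>t. t \<in> {0..} \<Longrightarrow> t \<noteq> 0 \<Longrightarrow> dist t 0 < d \<Longrightarrow> dist (\<omega> t) 0 < \<epsilon>"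
    using lim assms(3) unfolding Lim_within by (metis zero_less_dist_iff)
  \<comment> \<open>The limit controls \<omega> only at nonzero arguments below \<open>d\<close>.
    Half of \<open>d\<close> is such an argument, and monotonicity carries the bound to all
    distances up to \<delta>, including 0.\<close>
  define \<delta> where "\<delta> = d / 2"
  have \<delta>: "\<delta> > 0" "\<omega> \<delta> \<le> \<epsilon>"
    using d(1) d(2)[of \<delta>] by (auto simp: \<delta>_def)
  have f: "f \<in> CB"
    using H_omega_subset_CB assms by blast
  \<comment> \<open>Chosen so that the quadratic term equals the trivial bound on the oscillation of
    \<open>f\<close> exactly at distance \<delta>.\<close>
  define K where "K = 2 * CB_norm f / \<delta>\<^sup>2"
  have K: "K \<ge> 0"
    unfolding K_def using CB_norm_nonneg[OF f] by simp
  have "\<bar>f u - f z\<bar> \<le> \<epsilon> + K * (norm (squash u - squash z))\<^sup>2"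
    if uz: "u \<in> quadrant" "z \<in> quadrant" for u z
  proof (cases "norm (squash u - squash z) \<le> \<delta>")
    case True
    have "\<bar>f u - f z\<bar> \<le> \<omega> (norm (squash u - squash z))"
      using H_omega_squash assms(2) uz by blast
    also have "\<dots> \<le> \<omega> \<delta>"
      using True \<delta>(1) by (intro mono_onD[OF mono]) auto
    finally show ?thesis
      using \<delta>(2) K by (smt (verit) mult_nonneg_nonneg zero_le_power2)
  next
    case False
    have "\<bar>f u - f z\<bar> \<le> 2 * CB_norm f"
      using abs_le_CB_norm[OF f uz(1)] abs_le_CB_norm[OF f uz(2)] by linarith
    also have "\<dots> = K * \<delta>\<^sup>2"
      using \<delta>(1) by (simp add: K_def)
    also have "\<dots> \<le> K * (norm (squash u - squash z))\<^sup>2"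
      using False \<delta>(1) K by (intro mult_left_mono power_mono) auto
    finally show ?thesis
      using assms(3) by linarith
  qed
  with K show ?thesis
    by (rule that)
qed

text \<open>Korovkin's estimate at a single point, for any sum with nonnegative weights. The total
  weight may differ from 1; \<open>D 0 0\<close> measures this defect and so enters with the factors
  \<epsilon>, \<open>\<bar>f z\<bar>\<close> and \<open>K\<close>.\<close>

lemma positive_sum_estimate:
  fixes S :: "'i set" and w :: "'i \<Rightarrow> real" and t :: "'i \<Rightarrow> real \<times> real" and z :: "real \<times> real"
  defines "L g \<equiv> \<Sum>i\<in>S. g (t i) * w i"
  defines "D i j \<equiv> \<bar>L (test_fun i j) - test_fun i j z\<bar>"
  assumes w: "\<And>i. i \<in> S \<Longrightarrow> 0 \<le> w i"
    and z: "z \<in> quadrant" and K: "0 \<le> K" and \<epsilon>: "0 \<le> \<epsilon>"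
    and bound: "\<And>i. i \<in> S \<Longrightarrow> \<bar>f (t i) - f z\<bar> \<le> \<epsilon> + K * (norm (squash (t i) - squash z))\<^sup>2"
  shows "\<bar>L f - f z\<bar> \<le>
    \<epsilon> + (\<epsilon> + \<bar>f z\<bar>) * D 0 0 + K * (D 2 0 + D 0 2 + 2 * D 1 0 + 2 * D 0 1 + 2 * D 0 0)"
proof -
  define a where "a = fst (squash z)"
  define b where "b = snd (squash z)"
  define Q where "Q = L (\<lambda>u. (norm (squash u - squash z))\<^sup>2)"
  have ab: "0 \<le> a" "a \<le> 1" "0 \<le> b" "b \<le> 1"
    using squash_bounds[OF z] by (auto simp: a_def b_def)
  have one: "test_fun 0 0 = (\<lambda>_. 1)"
    by (auto simp: test_fun_squash)
  define E where "E i j = L (test_fun i j) - test_fun i j z" for i j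
  \<comment> \<open>Expanding the square expresses \<open>Q\<close> through the values of
    \<open>L\<close> on the test functions. The same combination of their values at \<open>z\<close>
    is \<open>(a - a)\<^sup>2 + (b - b)\<^sup>2 = 0\<close>, so only the errors remain.\<close>
  have Q_eq: "Q = E 2 0 - 2 * (a * E 1 0) + a\<^sup>2 * E 0 0
      + (E 0 2 - 2 * (b * E 0 1) + b\<^sup>2 * E 0 0)"
  proof -
    have norm_sq: "(norm (squash u - squash z))\<^sup>2
        = (fst (squash u) - a)\<^sup>2 + (snd (squash u) - b)\<^sup>2" for u
      by (simp add: norm_prod_def a_def b_def)
    have "Q = L (test_fun 2 0) - 2 * a * L (test_fun 1 0) + a\<^sup>2 * L (test_fun 0 0)
        + (L (test_fun 0 2) - 2 * b * L (test_fun 0 1) + b\<^sup>2 * L (test_fun 0 0))"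
      unfolding Q_def L_def sum_distrib_left sum_subtractf[symmetric] sum.distrib[symmetric]
      by (simp add: norm_sq test_fun_squash) (simp add: power2_eq_square algebra_simps)
    then show ?thesis
      by (simp add: E_def test_fun_squash flip: a_def b_def) (simp add: power2_eq_square algebra_simps)
  qed
  \<comment> \<open>The coefficients in \<open>Q_eq\<close> depend on \<open>z\<close> but come from
    the unit square; dropping them makes the bound on \<open>Q\<close> uniform in
    \<open>z\<close>.\<close>
  have scale: "\<bar>c * r\<bar> \<le> \<bar>r\<bar>" if "0 \<le> c" "c \<le> 1" for c r :: real
    using that by (simp add: abs_mult mult_left_le_one_le)
  have ab2: "a\<^sup>2 \<le> 1" "b\<^sup>2 \<le> 1"
    using ab by (auto simp: power_le_one)
  have Q_le: "Q \<le> D 2 0 + D 0 2 + 2 * D 1 0 + 2 * D 0 1 + 2 * D 0 0"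
    unfolding Q_eq D_def E_def[symmetric]
    using scale[OF ab(1,2), of "E 1 0"] scale[OF ab(3,4), of "E 0 1"]
      scale[OF zero_le_power2 ab2(1), of "E 0 0"] scale[OF zero_le_power2 ab2(2), of "E 0 0"]
    by linarith
  have L_one: "L (test_fun 0 0) \<le> 1 + D 0 0"
    by (simp add: D_def one)
  \<comment> \<open>Separates the oscillation of \<open>f\<close> around \<open>z\<close> from the
    error caused by the total weight.\<close>
  have "L f - f z = (\<Sum>i\<in>S. (f (t i) - f z) * w i) + f z * (L (test_fun 0 0) - 1)"
    by (simp add: L_def one algebra_simps sum_subtractf sum_distrib_left)
  then have "\<bar>L f - f z\<bar> \<le> \<bar>\<Sum>i\<in>S. (f (t i) - f z) * w i\<bar> + \<bar>f z\<bar> * D 0 0"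
    by (simp add: D_def one abs_mult[symmetric])
  also have "\<bar>\<Sum>i\<in>S. (f (t i) - f z) * w i\<bar>
      \<le> (\<Sum>i\<in>S. (\<epsilon> + K * (norm (squash (t i) - squash z))\<^sup>2) * w i)"
    by (rule order_trans[OF sum_abs sum_mono])
      (use w bound in \<open>auto simp: abs_mult intro!: mult_right_mono\<close>)
  also have "\<dots> = \<epsilon> * L (test_fun 0 0) + K * Q"
    by (simp add: L_def Q_def one algebra_simps sum.distrib sum_distrib_left)
  also have "\<dots> \<le> \<epsilon> * (1 + D 0 0) + K * (D 2 0 + D 0 2 + 2 * D 1 0 + 2 * D 0 1 + 2 * D 0 0)"
    using L_one Q_le K \<epsilon> by (intro add_mono mult_left_mono)
  finally show ?thesis
    by (simp add: algebra_simps)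
qed

lemma pq_int_nonneg:
  assumes "0 < q" "q < p"
  shows "0 \<le> pq_int p q n"
  using assms by (simp add: pq_int_def power_mono)

text \<open>Keeps the sampling points in the quadrant, where the quadratic bound on \<open>f\<close>
  is available.\<close>

lemma BBH_node_nonneg:
  assumes "0 < q" "q < p"
  shows "0 \<le> BBH_node p q n k"
  unfolding BBH_node_def using assms pq_int_nonneg[OF assms]
  by (intro divide_nonneg_nonneg mult_nonneg_nonneg) auto

lemma BBH_weight_nonneg:
  assumes "0 < q" "q < p" "0 \<le> x"
  shows "0 \<le> BBH_weight p q n k x"
proof -
  have "0 \<le> pq_fact p q m" for m
    unfolding pq_fact_def using pq_int_nonneg assms by (intro prod_nonneg) auto
  then have "0 \<le> pq_binom p q n k"
    by (simp add: pq_binom_def)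
  then show ?thesis
    unfolding BBH_weight_def using assms BBH_ell_pos[of q p x n]
    by (intro mult_nonneg_nonneg) auto
qed

text \<open>At each point the operator is a nonnegative weighted sum over a grid of nodes, so the
  pointwise estimate applies. Its right-hand side is then bounded by norms, free of
  \<open>z\<close>, and the supremum can be taken.\<close>

lemma BBH_norm_estimate:
  fixes p1 p2 q1 q2 :: real and n1 n2 :: nat
  defines "L \<equiv> BBH p1 p2 q1 q2 n1 n2"
  defines "N i j \<equiv> CB_norm (\<lambda>z. L (test_fun i j) z - test_fun i j z)"
  assumes pq: "0 < q1" "q1 < p1" "0 < q2" "q2 < p2"
    and f: "f \<in> CB" and K: "0 \<le> K" and \<epsilon>: "0 \<le> \<epsilon>"
    and bound: "\<And>u z. u \<in> quadrant \<Longrightarrow> z \<in> quadrant \<Longrightarrow>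
      \<bar>f u - f z\<bar> \<le> \<epsilon> + K * (norm (squash u - squash z))\<^sup>2"
  shows "CB_norm (\<lambda>z. L f z - f z) \<le>
    \<epsilon> + (\<epsilon> + CB_norm f) * N 0 0 + K * (N 2 0 + N 0 2 + 2 * N 1 0 + 2 * N 0 1 + 2 * N 0 0)"
proof (rule CB_norm_le)
  fix z assume z: "z \<in> quadrant"
  let ?S = "{0..n1} \<times> {0..n2}"
  let ?t = "\<lambda>k. (BBH_node p1 q1 n1 (fst k), BBH_node p2 q2 n2 (snd k))"
  let ?w = "\<lambda>k. BBH_weight p1 q1 n1 (fst k) (fst z) * BBH_weight p2 q2 n2 (snd k) (snd z)"
  define D where "D i j = \<bar>L (test_fun i j) z - test_fun i j z\<bar>" for i j
  have L: "L g z = (\<Sum>k\<in>?S. g (?t k) * ?w k)" for g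
    by (simp add: L_def BBH_def sum.cartesian_product case_prod_unfold mult.assoc)
  have w: "0 \<le> ?w k" for k
    using z pq by (auto simp: quadrant_def intro!: mult_nonneg_nonneg BBH_weight_nonneg)
  have t: "?t k \<in> quadrant" for k
    using pq by (auto simp: quadrant_def intro!: BBH_node_nonneg)
  have D: "D i j \<le> N i j" for i j
    unfolding D_def N_def L_def using z pq
    by (intro abs_le_CB_norm[OF CB_diff] BBH_in_CB test_fun_in_CB) auto
  \<comment> \<open>Needed when both factors of
    \<open>(\<epsilon> + \<bar>f z\<bar>) * D 0 0\<close> are enlarged at once.\<close>
  have D0: "0 \<le> D i j" for i j
    by (simp add: D_def)
  have "\<bar>L f z - f z\<bar> \<le>
      \<epsilon> + (\<epsilon> + \<bar>f z\<bar>) * D 0 0 + K * (D 2 0 + D 0 2 + 2 * D 1 0 + 2 * D 0 1 + 2 * D 0 0)"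
    unfolding L D_def using w z K \<epsilon> bound[OF t z] by (rule positive_sum_estimate)
  also have "\<dots> \<le>
      \<epsilon> + (\<epsilon> + CB_norm f) * N 0 0 + K * (N 2 0 + N 0 2 + 2 * N 1 0 + 2 * N 0 1 + 2 * N 0 0)"
    using K \<epsilon> D D0 abs_le_CB_norm[OF f z] CB_norm_nonneg[OF f]
    by (intro add_mono mult_mono mult_left_mono) auto
  finally show "\<bar>L f z - f z\<bar> \<le>
      \<epsilon> + (\<epsilon> + CB_norm f) * N 0 0 + K * (N 2 0 + N 0 2 + 2 * N 1 0 + 2 * N 0 1 + 2 * N 0 0)" .
qed

theorem theorem3p3:
  fixes p1 q1 p2 q2 :: "nat \<Rightarrow> real" and \<omega> :: "real \<Rightarrow> real"
  assumes "\<And>n. n \<ge> 1 \<Longrightarrow> 0 < q1 n \<and> q1 n < p1 n \<and> p1 n \<le> 1"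
    and "\<And>n. n \<ge> 1 \<Longrightarrow> 0 < q2 n \<and> q2 n < p2 n \<and> p2 n \<le> 1"
    and "p1 \<longlonglongrightarrow> 1" and "q1 \<longlonglongrightarrow> 1"
    and "p2 \<longlonglongrightarrow> 1" and "q2 \<longlonglongrightarrow> 1"
    and "modulus_type \<omega>"
    and "\<And>i j. (i, j) \<in> {(0, 0), (1, 0), (0, 1), (2, 0), (0, 2)} \<Longrightarrow>
      ((\<lambda>(n1, n2). CB_norm (\<lambda>z.
          BBH (p1 n1) (p2 n2) (q1 n1) (q2 n2) n1 n2 (test_fun i j) z - test_fun i j z)) \<longlongrightarrow> 0)
        (sequentially \<times>\<^sub>F sequentially)"
  shows "\<forall>f\<in>H_omega \<omega>.
      ((\<lambda>(n1, n2). CB_norm (\<lambda>z.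
          BBH (p1 n1) (p2 n2) (q1 n1) (q2 n2) n1 n2 f z - f z)) \<longlongrightarrow> 0)
        (sequentially \<times>\<^sub>F sequentially)"
proof
  fix f assume f: "f \<in> H_omega \<omega>"
  let ?F = "sequentially \<times>\<^sub>F sequentially"
  define E where "E = (\<lambda>g (n1, n2). CB_norm (\<lambda>z.
    BBH (p1 n1) (p2 n2) (q1 n1) (q2 n2) n1 n2 g z - g z))"
  have fCB: "f \<in> CB"
    using H_omega_subset_CB assms(7) f by blast
  have N: "(E (test_fun i j) \<longlongrightarrow> 0) ?F"
    if "(i, j) \<in> {(0, 0), (1, 0), (0, 1), (2, 0), (0, 2)}" for i j
    using assms(8)[OF that] by (simp add: E_def)
  \<comment> \<open>The conditions on the parameters, and with them positivity, are given only from
    index 1 on.\<close>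
  have ge1: "eventually (\<lambda>n. fst n \<ge> 1 \<and> snd n \<ge> 1) ?F"
    unfolding eventually_prod_sequentially by (auto intro!: exI[of _ 1])
  have "(E f \<longlongrightarrow> 0) ?F"
  proof (rule tendstoI)
    fix e :: real assume e: "e > 0"
    \<comment> \<open>\<open>K\<close> is fixed before the indices grow, so the error terms
      multiplied by it still vanish in the limit; \<open>e / 2\<close> leaves room for them.\<close>
    obtain K where K: "K \<ge> 0" "\<And>u z. u \<in> quadrant \<Longrightarrow> z \<in> quadrant \<Longrightarrow>
        \<bar>f u - f z\<bar> \<le> e / 2 + K * (norm (squash u - squash z))\<^sup>2"
      using H_omega_quadratic_bound[OF assms(7) f] e half_gt_zero by metis
    define B where "B n = e / 2 + (e / 2 + CB_norm f) * E (test_fun 0 0) n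
      + K * (E (test_fun 2 0) n + E (test_fun 0 2) n + 2 * E (test_fun 1 0) n
        + 2 * E (test_fun 0 1) n + 2 * E (test_fun 0 0) n)" for n
    have "(B \<longlongrightarrow> e / 2 + (e / 2 + CB_norm f) * 0 + K * (0 + 0 + 2 * 0 + 2 * 0 + 2 * 0)) ?F"
      unfolding B_def by (intro tendsto_intros N) auto
    then have "eventually (\<lambda>n. B n < e) ?F"
      by (rule order_tendstoD) (use e in auto)
    then show "eventually (\<lambda>n. dist (E f n) 0 < e) ?F"
      using ge1
    proof eventually_elim
      case (elim n)
      have pq: "0 < q1 (fst n)" "q1 (fst n) < p1 (fst n)" "0 < q2 (snd n)" "q2 (snd n) < p2 (snd n)"
        using assms(1,2) elim by auto
      have "E f n \<le> B n"
        unfolding E_def B_def case_prod_unfold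
        by (rule BBH_norm_estimate) (use pq fCB K e in auto)
      \<comment> \<open>Identifies the distance from 0 with \<open>E f n\<close> itself; membership
        in \<open>CB\<close> makes the supremum a genuine norm.\<close>
      moreover have "0 \<le> E f n"
        unfolding E_def case_prod_unfold using pq fCB
        by (intro CB_norm_nonneg CB_diff BBH_in_CB) auto
      ultimately show ?case
        using elim by simp
    qed
  qed
  then show "((\<lambda>(n1, n2). CB_norm (\<lambda>z.
      BBH (p1 n1) (p2 n2) (q1 n1) (q2 n2) n1 n2 f z - f z)) \<longlongrightarrow> 0) ?F"
    by (simp add: E_def)
qed

end
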